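(* Let $p$ be a prime number and let $G$ be a nonempty graph which is properly colored with an arbitrary number of colors. Then there is a multicolored complete $p$-partite subgraph $K_{n_1,n_2,\ldots,n_p}$ of $G$ such that - $\sum_{i=1}^p n_i=\mathrm{ind}_{\mathbb Z_p}(B_0(G,\mathbb Z_p))+1$, and - $|n_i-n_j|\leq 1$ for all $i,j\in[p]$. Moreover, if $p\leq\omega(G)$, then $\mathrm{ind}_{\mathbb Z_p}(B_0(G,\mathbb Z_p))+1$ can be replaced with $\mathrm{Xind}_{\mathbb Z_p}(\mathrm{Hom}(K_p,G))+p$; that is, there is a multicolored complete $p$-partite subgraph $K_{n_1,\dots,n_p}$ of $G$ with $\sum_{i=1}^p n_i=\mathrm{Xind}_{\mathbb Z_p}(\mathrm{Hom}(K_p,G))+p$ and $|n_i-n_j|\leq1$ for all $i,j\in[p]$.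
   Context: A graph is a finite 2-uniform hypergraph (all edges are 2-element sets of vertices); nonempty means having at least one edge. A subgraph of a properly colored graph is multicolored if its vertices get pairwise distinct colors. $K_{n_1,\dots,n_p}$ is the complete $p$-partite graph with parts of sizes $n_1,\dots,n_p$ (parts may be empty). $\omega(G)$ is the clique number. For pairwise disjoint $U_1,\dots,U_p\subseteq V(G)$, $G[U_1,\dots,U_p]$ is the graph with vertex set $\bigcup_iU_i$ and edges those edges of $G$ joining vertices in two different $U_i$'s; it is complete $p$-partite if every two vertices in different $U_i$'s are adjacent. Index. $\mathbb Z_p=\{\omega^1,\dots,\omega^p\}$ is the cyclic group of order $p$ with generator $\omega$. A simplicial $\mathbb Z_p$-complex is a simplicial complex with a $\mathbb Z_p$-action on its vertices by simplicial maps; it is free if no non-identity element fixes a simplex. $E_n\mathbb Z_p$ denotes any free $(n-1)$-connected $n$-dimensional simplicial $\mathbb Z_p$-complex, e.g. the $(n+1)$-fold join $\mathbb Z_p^{*(n+1)}$. For a $\mathbb Z_p$-space $X$, $\mathrm{ind}_{\mathbb Z_p}(X)$ is the least $n$ such that there is a continuous $\mathbb Z_p$-equivariant map $X\to E_n\mathbb Z_p$ (independent of the choice of $E_n\mathbb Z_p$); for a simplicial complex $K$, $\mathrm{ind}_{\mathbb Z_p}(K)$ means $\mathrm{ind}_{\mathbb Z_p}(\|K\|)$, with $\|K\|$ the geometric realization. Box complex. $B_0(G,\mathbb Z_p)$ is the simplicial complex with vertex set $\mathbb Z_p\times V(G)$ whose simplices are all sets $\{\omega^1\}\times U_1\cup\dots\cup\{\omega^p\}\times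 U_p$ with $U_1,\dots,U_p$ pairwise disjoint subsets of $V(G)$ (some possibly empty), $\bigcup_iU_i\neq\varnothing$, and $G[U_1,\dots,U_p]$ complete $p$-partite. $\mathbb Z_p$ acts freely by $\epsilon\cdot(\epsilon',v)=(\epsilon\epsilon',v)$. Cross-index. A $\mathbb Z_p$-poset is a poset on which $\mathbb Z_p$ acts by order automorphisms; it is free if non-identity elements have no fixed points. $Q_{n,p}$ is the free $\mathbb Z_p$-poset on $\mathbb Z_p\times[n+1]$ with $(\epsilon,i)<(\epsilon',j)$ iff $i<j$ and action $\epsilon\cdot(\epsilon',j)=(\epsilon\epsilon',j)$. $\mathrm{Xind}_{\mathbb Z_p}(P)$ is the least $n$ such that there is an order-preserving $\mathbb Z_p$-equivariant map $P\to Q_{n,p}$. Hom complex. $\mathrm{Hom}(K_p,G)$ is the free $\mathbb Z_p$-poset of all ordered $p$-tuples $(U_1,\dots,U_p)$ of nonempty pairwise disjoint subsets of $V(G)$ such that $G[U_1,\dots,U_p]$ is complete $p$-partite, ordered by $(U_1,\dots,U_p)\preceq(U'_1,\dots,U'_p)$ iff $U_i\subseteq U'_i$ for all $i$, with action $\omega^i\cdot(U_1,\dots,U_p)=(U_{1+i},\dots,U_{p+i})$, where $U_j=U_{j-p}$ for $j>p$. *)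

theory Defs
  imports
    "HOL-Algebra.Elementary_Groups"
    "HOL-Analysis.Function_Topology"
    "HOL-Computational_Algebra.Primes"
    "HOL-Library.Disjoint_Sets"
    "HOL-Library.Extended_Nat"
    "HOL-Library.Ramsey"
begin

definition is_graph :: "'v set \<Rightarrow> 'v set set \<Rightarrow> bool" where
  "is_graph V E \<longleftrightarrow> finite V \<and> E \<subseteq> [V]\<^bsup>2\<^esup>"

definition is_subgraph :: "'v set \<Rightarrow> 'v set set \<Rightarrow> 'v set \<Rightarrow> 'v set set \<Rightarrow> bool" where
  "is_subgraph W F V E \<longleftrightarrow> is_graph W F \<and> W \<subseteq> V \<and> F \<subseteq> E"

definition clique_number :: "'v set \<Rightarrow> 'v set set \<Rightarrow> nat" where
  "clique_number V E = Max {card C | C. C \<subseteq> V \<and> clique C E}"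

definition proper_coloring :: "'v set set \<Rightarrow> ('v \<Rightarrow> 'c) \<Rightarrow> bool" where
  "proper_coloring E c \<longleftrightarrow> (\<forall>u v. {u, v} \<in> E \<longrightarrow> c u \<noteq> c v)"

definition multicolored :: "('v \<Rightarrow> 'c) \<Rightarrow> 'v set \<Rightarrow> bool" where
  "multicolored c W \<longleftrightarrow> inj_on c W"

text \<open>The pairs of points lying in two different members of a family.  The edge set of
  $G[U_1,\dots,U_p]$ is the intersection of \<open>E\<close> with these pairs, so that
  $G[U_1,\dots,U_p]$ is complete \<open>p\<close>-partite iff all of them are edges.\<close>

definition cross_pairs :: "'i set \<Rightarrow> ('i \<Rightarrow> 'v set) \<Rightarrow> 'v set set" where
  "cross_pairs I U = {{u, v} | u v. \<exists>i\<in>I. \<exists>j\<in>I. i \<noteq> j \<and> u \<in> U i \<and> v \<in> U j}"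

definition complete_multipartite :: "'v set set \<Rightarrow> 'i set \<Rightarrow> ('i \<Rightarrow> 'v set) \<Rightarrow> bool" where
  "complete_multipartite E I U \<longleftrightarrow> cross_pairs I U \<subseteq> E"

text \<open>\<open>(W, F)\<close> is a copy of $K_{n_1,\dots,n_p}$; parts may be empty.\<close>

definition is_complete_multipartite_graph ::
    "nat \<Rightarrow> (nat \<Rightarrow> nat) \<Rightarrow> 'v set \<Rightarrow> 'v set set \<Rightarrow> bool" where
  "is_complete_multipartite_graph p n W F \<longleftrightarrow>
     (\<exists>U. disjoint_family_on U {1..p} \<and> (\<forall>i\<in>{1..p}. finite (U i) \<and> card (U i) = n i) \<and>
          W = (\<Union>i\<in>{1..p}. U i) \<and> F = cross_pairs {1..p} U)"

text \<open>The cyclic group of order \<open>p\<close> is written additively: $\omega^i$ is the residue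
  \<open>i mod p\<close>.  A family $(U_1,\dots,U_p)$ entering one of the complexes below is indexed by the
  group, $U_i$ standing at $\omega^i$ (so $U_p$ stands at the residue \<open>0\<close>).\<close>

abbreviation Zp :: "nat \<Rightarrow> int monoid" where
  "Zp \<equiv> integer_mod_group"

definition translate :: "nat \<Rightarrow> int \<Rightarrow> int \<times> 'a \<Rightarrow> int \<times> 'a" where
  "translate p g = (\<lambda>(h, x). (g \<otimes>\<^bsub>Zp p\<^esub> h, x))"

text \<open>An abstract simplicial complex is given by its set of (nonempty, finite) simplices.
  Points of the realization are given by their barycentric coordinates.  The topology is that
  of pointwise convergence, which is the usual one for finite complexes; no others are used.\<close>

definition realization :: "'a set set \<Rightarrow> ('a \<Rightarrow> real) set" where
  "realization K = {x. (\<forall>v. 0 \<le> x v) \<and> {v. x v \<noteq> 0} \<in> K \<and> (\<Sum>v | x v \<noteq> 0. x v) = 1}"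

definition realization_topology :: "'a set set \<Rightarrow> ('a \<Rightarrow> real) topology" where
  "realization_topology K = top_of_set (realization K)"

text \<open>The affine extension of a vertex map: the coordinates are pushed forward, as vertex maps such as
  the action need not be injective off the vertex set.\<close>

definition realization_map :: "('a \<Rightarrow> 'b) \<Rightarrow> ('a \<Rightarrow> real) \<Rightarrow> 'b \<Rightarrow> real" where
  "realization_map f x = (\<lambda>w. \<Sum>v | x v \<noteq> 0 \<and> f v = w. x v)"

text \<open>The \<open>(n+1)\<close>-fold join of the discrete space \<open>Zp p\<close>, as the model of $E_n\mathbb{Z}_p$.\<close>

definition EnZp :: "nat \<Rightarrow> nat \<Rightarrow> (int \<times> nat) set set" where
  "EnZp n p = {s. s \<noteq> {} \<and> s \<subseteq> carrier (Zp p) \<times> {1..n+1} \<and> inj_on snd s}"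

text \<open>The infimum is \<open>\<infinity>\<close> if there is no equivariant map for any \<open>n\<close>.\<close>

definition space_index :: "nat \<Rightarrow> 'a topology \<Rightarrow> (int \<Rightarrow> 'a \<Rightarrow> 'a) \<Rightarrow> enat" where
  "space_index p X act = Inf {enat n | n. \<exists>f.
     continuous_map X (realization_topology (EnZp n p)) f \<and>
     (\<forall>g\<in>carrier (Zp p). \<forall>x\<in>topspace X.
        f (act g x) = realization_map (translate p g) (f x))}"

definition complex_index :: "nat \<Rightarrow> 'a set set \<Rightarrow> (int \<Rightarrow> 'a \<Rightarrow> 'a) \<Rightarrow> enat" where
  "complex_index p K act =
     space_index p (realization_topology K) (\<lambda>g. realization_map (act g))"

definition box_complex :: "nat \<Rightarrow> 'v set \<Rightarrow> 'v set set \<Rightarrow> (int \<times> 'v) set set" where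
  "box_complex p V E = {Sigma (carrier (Zp p)) U | U.
     (\<forall>i\<in>carrier (Zp p). U i \<subseteq> V) \<and> disjoint_family_on U (carrier (Zp p)) \<and>
     (\<Union>i\<in>carrier (Zp p). U i) \<noteq> {} \<and> complete_multipartite E (carrier (Zp p)) U}"

definition ind_box :: "nat \<Rightarrow> 'v set \<Rightarrow> 'v set set \<Rightarrow> enat" where
  "ind_box p V E = complex_index p (box_complex p V E) (translate p)"

definition Qposet :: "nat \<Rightarrow> nat \<Rightarrow> (int \<times> nat) set" where
  "Qposet n p = carrier (Zp p) \<times> {1..n+1}"

definition Q_le :: "int \<times> nat \<Rightarrow> int \<times> nat \<Rightarrow> bool" where
  "Q_le x y \<longleftrightarrow> x = y \<or> snd x < snd y"

definition cross_index ::
    "nat \<Rightarrow> 'a set \<Rightarrow> ('a \<Rightarrow> 'a \<Rightarrow> bool) \<Rightarrow> (int \<Rightarrow> 'a \<Rightarrow> 'a) \<Rightarrow> enat" where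
  "cross_index p P leq act = Inf {enat n | n. \<exists>f.
     f \<in> P \<rightarrow> Qposet n p \<and>
     (\<forall>x\<in>P. \<forall>y\<in>P. leq x y \<longrightarrow> Q_le (f x) (f y)) \<and>
     (\<forall>g\<in>carrier (Zp p). \<forall>x\<in>P. f (act g x) = translate p g (f x))}"

definition Hom_complex :: "nat \<Rightarrow> 'v set \<Rightarrow> 'v set set \<Rightarrow> (int \<Rightarrow> 'v set) set" where
  "Hom_complex p V E = {U \<in> carrier (Zp p) \<rightarrow>\<^sub>E Pow V - {{}}.
     disjoint_family_on U (carrier (Zp p)) \<and> complete_multipartite E (carrier (Zp p)) U}"

definition Hom_le :: "nat \<Rightarrow> (int \<Rightarrow> 'v set) \<Rightarrow> (int \<Rightarrow> 'v set) \<Rightarrow> bool" where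
  "Hom_le p U U' \<longleftrightarrow> (\<forall>i\<in>carrier (Zp p). U i \<subseteq> U' i)"

definition Hom_act :: "nat \<Rightarrow> int \<Rightarrow> (int \<Rightarrow> 'v set) \<Rightarrow> int \<Rightarrow> 'v set" where
  "Hom_act p g U = (\<lambda>h\<in>carrier (Zp p). U (g \<otimes>\<^bsub>Zp p\<^esub> h))"

definition Xind_Hom :: "nat \<Rightarrow> 'v set \<Rightarrow> 'v set set \<Rightarrow> enat" where
  "Xind_Hom p V E = cross_index p (Hom_complex p V E) (Hom_le p) (Hom_act p)"

end

theory Submission
  imports Defs
begin

text \<open>
  A proper coloring maps the parts of a complete \<open>p\<close>-partite subgraph \<open>(U i)\<close> to pairwise disjoint sets of
  colors \<open>c ` U i\<close>.  Choosing one vertex per color turns a balanced choice of colors, one that takes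
  nearly equally many from each of these sets, into a multicolored balanced subgraph.  So it
  suffices to find a complete \<open>p\<close>-partite subgraph whose color sets have a large
  \<^emph>\<open>balanced size\<close>, the maximal number of colors in a balanced choice
  (lemma \<open>multicolored_subgraph_exists\<close>).

  Suppose all balanced sizes are at most \<open>m\<close>.  Then a simplex of the box complex, or an element of the
  Hom complex, can be sent to a level, the balanced size of its color sets, together with a sign
  in \<open>Zp p\<close>.  When a family of color sets grows while its balanced size stays the same, the set of
  indices of parts larger than the smallest one stays the same, and if there is no such part the
  family itself does (lemma \<open>balanced_size_mono\<close>).  In both cases this provides a nonconstant
  function on \<open>Zp p\<close> depending only on the level within a chain.  As \<open>p\<close> is prime, \<open>Zp p\<close> acts
  freely on nonconstant functions, and they can be given signs equivariantly
  (lemma \<open>equivariant_choice\<close>).  Level and sign form an order-preserving equivariant map to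
  \<open>Qposet\<close>, so the number of levels that can occur bounds the cross-index
  (lemma \<open>cross_index_le_balanced_size\<close>).  The levels run from 1 to \<open>m\<close> for the box complex and from
  \<open>p\<close> to \<open>m\<close> for the Hom complex, so its cross-index plus 1, respectively plus \<open>p\<close>, is at most \<open>m\<close>.

  For the Hom complex this is the claim.  For the box complex it remains to compare the
  topological index with the cross-index of the face poset: an order-preserving equivariant map on
  the simplices extends affinely over the barycentric subdivision
  (lemma \<open>complex_index_le_cross_index\<close>).  Both indices are thus bounded above by balanced sizes,
  and totals below a balanced size are reached by taking fewer colors.
\<close>

section \<open>Balanced subfamilies of a family of sets\<close>

definition min_part :: "'i set \<Rightarrow> ('i \<Rightarrow> 'a set) \<Rightarrow> nat" where
  "min_part I A = Min ((\<lambda>i. card (A i)) ` I)"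

definition large_parts :: "'i set \<Rightarrow> ('i \<Rightarrow> 'a set) \<Rightarrow> 'i set" where
  "large_parts I A = {i \<in> I. min_part I A < card (A i)}"

text \<open>The largest total size of a choice of subsets \<open>B i \<subseteq> A i\<close> whose cardinalities differ by at
  most one: every \<open>B i\<close> takes \<open>min_part I A\<close> elements, and the large parts give one more each.\<close>

definition balanced_size :: "'i set \<Rightarrow> ('i \<Rightarrow> 'a set) \<Rightarrow> nat" where
  "balanced_size I A = card I * min_part I A + card (large_parts I A)"

lemma min_part_le: "finite I \<Longrightarrow> i \<in> I \<Longrightarrow> min_part I A \<le> card (A i)"
  by (auto simp: min_part_def)

lemma min_part_attained:
  assumes "finite I" "I \<noteq> {}"
  obtains i where "i \<in> I" "card (A i) = min_part I A"
proof -
  have "min_part I A \<in> (\<lambda>i. card (A i)) ` I"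
    unfolding min_part_def using assms by (intro Min_in) auto
  then show thesis using that by auto
qed

lemma card_large_parts_less:
  assumes "finite I" "I \<noteq> {}"
  shows "card (large_parts I A) < card I"
proof -
  obtain i where "i \<in> I" "card (A i) = min_part I A"
    using min_part_attained[OF assms] .
  then have "i \<in> I - large_parts I A" by (simp add: large_parts_def)
  moreover have "large_parts I A \<subseteq> I" by (auto simp: large_parts_def)
  ultimately have "large_parts I A \<subset> I" by blast
  then show ?thesis using assms psubset_card_mono by blast
qed

lemma card_eq_min_part:
  assumes "finite I" "large_parts I A = {}" "i \<in> I"
  shows "card (A i) = min_part I A"
proof -
  have "i \<notin> large_parts I A" using assms(2) by simp
  then have "card (A i) \<le> min_part I A" using assms(3) by (simp add: large_parts_def)
  then show ?thesis using min_part_le[OF assms(1,3), of A] by simp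
qed

lemma min_part_mono:
  assumes "finite I" "I \<noteq> {}" "\<And>i. i \<in> I \<Longrightarrow> card (A i) \<le> card (B i)"
  shows "min_part I A \<le> min_part I B"
proof -
  obtain i where "i \<in> I" "card (B i) = min_part I B"
    using min_part_attained[OF assms(1,2)] .
  then show ?thesis using min_part_le[OF assms(1)] assms(3) by (metis order_trans)
qed

text \<open>Some part has minimal cardinality and is not large, so the second summand of \<open>balanced_size\<close>
  stays below \<open>card I\<close>.  Comparing balanced sizes is therefore comparing the pairs
  (smallest cardinality, number of large parts) lexicographically.\<close>

lemma balanced_size_less:
  assumes "finite I" "I \<noteq> {}" "min_part I A < min_part I B"
  shows "balanced_size I A < balanced_size I B"
proof -
  have "balanced_size I A < card I * Suc (min_part I A)"
    using card_large_parts_less[OF assms(1,2)] by (simp add: balanced_size_def)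
  also have "\<dots> \<le> card I * min_part I B" using assms(3) by (intro mult_le_mono2) auto
  finally show ?thesis by (simp add: balanced_size_def)
qed

text \<open>When a family grows without changing its balanced size, both members of the pair above
  are constant, so the set of large parts cannot move; if no part is large, all parts have the same
  cardinality before and after, and nothing has grown.  This rigidity is what makes the sign
  defined below constant on each level of the balanced size.\<close>

lemma balanced_size_mono:
  assumes "finite I" "I \<noteq> {}" "\<And>i. i \<in> I \<Longrightarrow> finite (B i)" "\<And>i. i \<in> I \<Longrightarrow> A i \<subseteq> B i"
  shows "balanced_size I A \<le> balanced_size I B"
    and "balanced_size I A = balanced_size I B \<Longrightarrow> large_parts I A = large_parts I B"
    and "balanced_size I A = balanced_size I B \<Longrightarrow> large_parts I A = {} \<Longrightarrow> i \<in> I \<Longrightarrow> A i = B i"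
proof -
  have card_le: "card (A j) \<le> card (B j)" if "j \<in> I" for j
    using that assms by (meson card_mono)
  have min_le: "min_part I A \<le> min_part I B"
    using assms(1,2) card_le by (rule min_part_mono)
  have large_sub: "large_parts I A \<subseteq> large_parts I B" if "min_part I A = min_part I B"
    using that card_le by (fastforce simp: large_parts_def)
  have fin: "finite (large_parts I B)" using assms(1) by (simp add: large_parts_def)
  show "balanced_size I A \<le> balanced_size I B"
  proof (cases "min_part I A = min_part I B")
    case True
    then show ?thesis
      using card_mono[OF fin large_sub[OF True]] by (simp add: balanced_size_def)
  next
    case False
    then show ?thesis using balanced_size_less[OF assms(1,2)] min_le by (metis less_imp_le le_neq_implies_less)
  qed
  assume eq: "balanced_size I A = balanced_size I B"
  have min_eq: "min_part I A = min_part I B"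
    using balanced_size_less[OF assms(1,2)] min_le eq by (metis less_irrefl le_neq_implies_less)
  show large_eq: "large_parts I A = large_parts I B"
    using eq min_eq card_subset_eq[OF fin large_sub[OF min_eq]] by (simp add: balanced_size_def)
  assume empty: "large_parts I A = {}" and i: "i \<in> I"
  have "card (A i) = min_part I A" "card (B i) = min_part I B"
    using card_eq_min_part[OF assms(1) _ i] empty large_eq by auto
  then show "A i = B i" using min_eq assms(3,4) i by (simp add: card_subset_eq)
qed

lemma balanced_size_reindex:
  assumes "bij_betw \<pi> I I" "\<And>i. i \<in> I \<Longrightarrow> B i = A (\<pi> i)"
  shows "large_parts I B = {i \<in> I. \<pi> i \<in> large_parts I A}"
    and "\<pi> ` large_parts I B = large_parts I A"
    and "balanced_size I B = balanced_size I A"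
proof -
  have "(\<lambda>i. card (B i)) ` I = (\<lambda>i. card (A i)) ` \<pi> ` I"
    using assms(2) by (auto simp: image_image)
  then have min_eq: "min_part I B = min_part I A"
    using assms(1) by (simp add: min_part_def bij_betw_def)
  have maps: "\<pi> i \<in> I" if "i \<in> I" for i
    using assms(1) that by (rule bij_betwE[THEN bspec])
  show large: "large_parts I B = {i \<in> I. \<pi> i \<in> large_parts I A}"
    unfolding large_parts_def min_eq by (auto simp: maps assms(2))
  show image: "\<pi> ` large_parts I B = large_parts I A"
  proof
    show "\<pi> ` large_parts I B \<subseteq> large_parts I A" unfolding large by auto
    show "large_parts I A \<subseteq> \<pi> ` large_parts I B"
    proof
      fix j assume j: "j \<in> large_parts I A"
      then have "j \<in> \<pi> ` I" using assms(1) by (simp add: bij_betw_def large_parts_def)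
      then show "j \<in> \<pi> ` large_parts I B" using j unfolding large by blast
    qed
  qed
  have "inj_on \<pi> (large_parts I B)"
    using assms(1) by (rule bij_betw_imp_inj_on[THEN inj_on_subset]) (simp add: large)
  then have "bij_betw \<pi> (large_parts I B) (large_parts I A)"
    using image by (simp add: bij_betw_def)
  then show "balanced_size I B = balanced_size I A"
    using min_eq by (simp add: balanced_size_def bij_betw_same_card)
qed

lemma balanced_size_pos:
  assumes "finite I" "i \<in> I" "finite (A i)" "A i \<noteq> {}"
  shows "0 < balanced_size I A"
proof (cases "min_part I A = 0")
  case True
  then have "i \<in> large_parts I A" using assms by (simp add: large_parts_def card_gt_0_iff)
  moreover have "finite (large_parts I A)" using assms(1) by (simp add: large_parts_def)
  ultimately have "0 < card (large_parts I A)" by (auto simp: card_gt_0_iff)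
  then show ?thesis by (simp add: balanced_size_def)
next
  case False
  moreover have "0 < card I" using assms(1,2) by (auto simp: card_gt_0_iff)
  ultimately show ?thesis by (simp add: balanced_size_def)
qed

lemma card_le_balanced_size:
  assumes "finite I" "I \<noteq> {}" "\<And>i. i \<in> I \<Longrightarrow> finite (A i) \<and> A i \<noteq> {}"
  shows "card I \<le> balanced_size I A"
proof -
  obtain i where "i \<in> I" "card (A i) = min_part I A"
    using min_part_attained[OF assms(1,2)] .
  then have "1 \<le> min_part I A" 
    using assms(3)[of i] by (metis One_nat_def Suc_leI card_gt_0_iff)
  then have "card I * 1 \<le> card I * min_part I A" by (rule mult_le_mono2)
  then show ?thesis unfolding balanced_size_def by linarith
qed

text \<open>Every total \<open>s\<close> up to the balanced size is realised, not only the maximal one: split \<open>s\<close>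
  evenly and give the remainder to parts that have room for it.\<close>

lemma balanced_profile_exists:
  assumes "finite I" "I \<noteq> {}" "s \<le> balanced_size I A"
  obtains n where "sum n I = s" "\<And>i. i \<in> I \<Longrightarrow> n i \<le> card (A i)"
    "\<And>i j. i \<in> I \<Longrightarrow> j \<in> I \<Longrightarrow> \<bar>int (n i) - int (n j)\<bar> \<le> 1"
proof -
  define q where "q = s div card I"
  have pos: "0 < card I" using assms by (simp add: card_gt_0_iff)
  have s: "s = card I * q + s mod card I" by (simp add: q_def)
  have "s < card I * Suc (min_part I A)"
    using assms(3) card_large_parts_less[OF assms(1,2), of A] by (simp add: balanced_size_def)
  then have "q < Suc (min_part I A)"
    unfolding q_def by (simp add: less_mult_imp_div_less mult.commute)
  then have q_le: "q \<le> min_part I A" by simp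
  \<comment> \<open>The parts with room for one more element are the large ones if \<open>q\<close> is the smallest
    cardinality, and all parts if \<open>q\<close> is below it.\<close>
  have "s mod card I \<le> card {i \<in> I. q < card (A i)}"
  proof (cases "q = min_part I A")
    case True
    then show ?thesis using s assms(3) by (simp add: balanced_size_def large_parts_def)
  next
    case False
    then have "{i \<in> I. q < card (A i)} = I"
      using q_le min_part_le[OF assms(1), of _ A] by fastforce
    then show ?thesis using pos by (simp add: less_imp_le)
  qed
  then obtain R where R: "R \<subseteq> {i \<in> I. q < card (A i)}" "card R = s mod card I"
    by (meson obtain_subset_with_card_n)
  define n where "n = (\<lambda>i. q + of_bool (i \<in> R))"
  have "sum n I = card I * q + card (I \<inter> R)"
    by (simp add: n_def sum.distrib sum_of_bool_eq assms(1) Int_def)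
  moreover have "I \<inter> R = R" using R(1) by auto
  ultimately have "sum n I = s" using R(2) s by simp
  moreover have "n i \<le> card (A i)" if "i \<in> I" for i
    using R(1) q_le min_part_le[OF assms(1) that, of A] by (auto simp: n_def)
  moreover have "\<bar>int (n i) - int (n j)\<bar> \<le> 1" for i j by (auto simp: n_def)
  ultimately show thesis by (rule that[of n])
qed

section \<open>Equivariant signs\<close>

text \<open>Functions on \<open>Zp p\<close> are represented by functions on the integers with period \<open>p\<close>.  The
  periods of a function form a subgroup of the integers; as \<open>p\<close> is prime, a subgroup containing \<open>p\<close>
  and a non-multiple of \<open>p\<close> contains 1.  Hence \<open>Zp p\<close> acts freely on nonconstant functions.
  This is where primality enters.\<close>

lemma prime_period_constant:
  fixes f :: "int \<Rightarrow> 'a"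
  assumes "prime p" and per: "\<And>i. f (i + int p) = f i"
    and g: "\<And>i. f (i - g) = f i" and "\<not> int p dvd g"
  shows "f i = f j"
proof -
  have periods: "f (k + a * d) = f k" if "\<And>i. f (i + d) = f i" for a d k
  proof (induction a rule: int_induct[where k = 0])
    case (step1 a)
    then show ?case using that[of "k + a * d"] by (simp add: algebra_simps)
  next
    case (step2 a)
    then show ?case using that[of "k + (a - 1) * d"] by (simp add: algebra_simps)
  qed simp
  have g': "f (i + g) = f i" for i using g[of "i + g"] by simp
  have "coprime (int p) g"
    using assms(1,4) by (simp add: prime_imp_coprime)
  then obtain a b where ab: "a * int p + b * g = 1"
    using bezout_int[of "int p" g] by auto
  have "f (k + 1) = f k" for k
    using periods[OF per, of k a] periods[OF g', of "k + a * int p" b] ab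
    by (simp add: add.assoc)
  from periods[OF this, of j "i - j"] show ?thesis by simp
qed

text \<open>A free action admits an equivariant map to the group: fix a representative in each orbit and
  send a function to the translation that carries the representative to it.\<close>

lemma equivariant_choice:
  assumes "prime p"
  shows "\<exists>s :: (int \<Rightarrow> 'a) \<Rightarrow> int. \<forall>f. (\<forall>i. f (i + int p) = f i) \<longrightarrow> (\<exists>a b. f a \<noteq> f b) \<longrightarrow>
           s f \<in> {0..<int p} \<and> (\<forall>g. s (\<lambda>i. f (i - g)) = (g + s f) mod int p)"
proof -
  have p: "0 < int p" using prime_gt_0_nat[OF assms] by simp
  define orb where "orb = (\<lambda>f :: int \<Rightarrow> 'a. range (\<lambda>g i. f (i - g)))"
  define rep where "rep = (\<lambda>f. SOME r. r \<in> orb f)"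
  define s where "s = (\<lambda>f. (SOME g. f = (\<lambda>i. rep f (i - g))) mod int p)"
  have orb_shift: "orb (\<lambda>i. f (i - g)) = orb f" for f g
  proof -
    have "(\<lambda>i. f (i - h)) = (\<lambda>i. f (i - (h - g) - g))" for h by simp
    moreover have "(\<lambda>i. f (i - h - g)) = (\<lambda>i. f (i - (h + g)))" for h by (simp add: algebra_simps)
    ultimately show ?thesis unfolding orb_def by (blast intro: range_eqI)
  qed
  have rep_shift: "rep (\<lambda>i. f (i - g)) = rep f" for f g
    by (simp add: rep_def orb_shift)
  have rep_eq: "f = (\<lambda>i. rep f (i - (SOME g. f = (\<lambda>i. rep f (i - g)))))" for f
  proof -
    have "f \<in> orb f" unfolding orb_def by (rule range_eqI[of _ _ 0]) simp
    then have "rep f \<in> orb f" unfolding rep_def by (rule someI[where P = "\<lambda>r. r \<in> orb f"])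
    then obtain g where "rep f = (\<lambda>i. f (i - g))" by (auto simp: orb_def)
    then have "f = (\<lambda>i. rep f (i - (- g)))" by simp
    then show ?thesis by (rule someI[where P = "\<lambda>g. f = (\<lambda>i. rep f (i - g))"])
  qed
  have shift: "s (\<lambda>i. f (i - g)) = (g + s f) mod int p"
    if per: "\<And>i. f (i + int p) = f i" and ne: "f a \<noteq> f b" for f g a b
  proof -
    define x where "x = (SOME g. f = (\<lambda>i. rep f (i - g)))"
    define y where "y = (SOME h. (\<lambda>i. f (i - g)) = (\<lambda>i. rep f (i - h)))"
    have fx: "f i = rep f (i - x)" for i using rep_eq[of f] unfolding x_def by metis
    have fy: "f (i - g) = rep f (i - y)" for i
      using rep_eq[of "\<lambda>i. f (i - g)"] unfolding y_def rep_shift by metis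
    have "f (i - (y - (g + x))) = f i" for i
      using fx[of "i - (y - (g + x))"] fy[of "i + g"] by (simp add: algebra_simps)
    then have "int p dvd y - (g + x)"
      using prime_period_constant[of p f "y - (g + x)" a b] assms per ne by blast
    then have "y mod int p = (g + x) mod int p" by (simp add: mod_eq_dvd_iff)
    moreover have "s (\<lambda>i. f (i - g)) = y mod int p" by (simp add: s_def y_def rep_shift)
    moreover have "s f = x mod int p" by (simp add: s_def x_def)
    ultimately show ?thesis by (simp add: mod_add_right_eq)
  qed
  have "s f \<in> {0..<int p}" for f using p by (simp add: s_def)
  with shift show ?thesis by (intro exI[of _ s]) blast
qed

text \<open>A nonconstant function on \<open>Zp p\<close> read off from a family of disjoint sets, chosen
  to stay the same when the family grows without changing its balanced size.  It marks the large parts; if there are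
  none, the marks are constant, and the parts themselves serve instead.\<close>

definition sign_pattern :: "nat \<Rightarrow> (int \<Rightarrow> 'a set) \<Rightarrow> int \<Rightarrow> bool \<times> 'a set" where
  "sign_pattern p A i =
     (let T = large_parts {0..<int p} A
      in (i mod int p \<in> T, if T = {} then A (i mod int p) else {}))"

text \<open>If some part is large, the smallest part is not, so the marks differ.  Otherwise all parts have
  the same positive cardinality, and disjoint nonempty sets differ.\<close>

lemma sign_pattern_nonconstant:
  assumes "1 < p" and disj: "disjoint_family_on A {0..<int p}"
    and pos: "0 < balanced_size {0..<int p} A"
  shows "\<exists>i j. sign_pattern p A i \<noteq> sign_pattern p A j"
proof (cases "large_parts {0..<int p} A = {}")
  case True
  have p: "1 < int p" using assms(1) by simp
  have "0 < min_part {0..<int p} A"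
    using pos True by (auto simp: balanced_size_def)
  then have "0 < card (A 0)"
    using min_part_le[of "{0..<int p}" 0 A] p by simp
  then have "A 0 \<noteq> {}" by auto
  moreover have "A 0 \<inter> A 1 = {}"
    using disj p by (auto simp: disjoint_family_on_def)
  ultimately have "A 0 \<noteq> A 1" by auto
  then have "sign_pattern p A 0 \<noteq> sign_pattern p A 1"
    using p True by (simp add: sign_pattern_def)
  then show ?thesis by blast
next
  case False
  then obtain i where i: "i \<in> large_parts {0..<int p} A" by auto
  have "0 < int p" using assms(1) by simp
  then obtain j where j: "j \<in> {0..<int p}" "card (A j) = min_part {0..<int p} A"
    using min_part_attained[of "{0..<int p}" A] by auto
  have "sign_pattern p A i \<noteq> sign_pattern p A j"
    using i j by (auto simp: sign_pattern_def Let_def large_parts_def)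
  then show ?thesis by blast
qed

lemma bij_betw_shift_mod:
  assumes "0 < int p"
  shows "bij_betw (\<lambda>i. (i - g) mod int p) {0..<int p} {0..<int p}"
proof (rule bij_betw_byWitness[where f' = "\<lambda>i. (i + g) mod int p"])
qed (use assms in \<open>auto simp: mod_simps\<close>)

lemma sign_pattern_shift:
  assumes "0 < p" and "\<And>i. i \<in> {0..<int p} \<Longrightarrow> B i = A ((i - g) mod int p)"
  shows "sign_pattern p B = (\<lambda>i. sign_pattern p A (i - g))"
    and "balanced_size {0..<int p} B = balanced_size {0..<int p} A"
proof -
  have p: "0 < int p" using assms(1) by simp
  let ?C = "{0..<int p}"
  note shift_bij = bij_betw_shift_mod[OF p, of g]
  have large: "large_parts ?C B = {i \<in> ?C. (i - g) mod int p \<in> large_parts ?C A}"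
    by (rule balanced_size_reindex(1)[OF shift_bij]) (rule assms(2))
  have image: "(\<lambda>i. (i - g) mod int p) ` large_parts ?C B = large_parts ?C A"
    by (rule balanced_size_reindex(2)[OF shift_bij]) (rule assms(2))
  show "balanced_size ?C B = balanced_size ?C A"
    by (rule balanced_size_reindex(3)[OF shift_bij]) (rule assms(2))
  have empty_iff: "large_parts ?C B = {} \<longleftrightarrow> large_parts ?C A = {}"
    unfolding image[symmetric] by simp
  have mod_C: "i mod int p \<in> ?C" for i using p by simp
  have "B (i mod int p) = A ((i - g) mod int p)" for i
    using assms(2)[OF mod_C[of i]] by (simp add: mod_simps)
  moreover have "i mod int p \<in> large_parts ?C B \<longleftrightarrow> (i - g) mod int p \<in> large_parts ?C A" for i
    using mod_C[of i] unfolding large by (simp add: mod_simps)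
  ultimately show "sign_pattern p B = (\<lambda>i. sign_pattern p A (i - g))"
    by (auto simp: sign_pattern_def Let_def empty_iff fun_eq_iff)
qed

section \<open>Bounding the cross-index\<close>

lemma carrier_Zp: "0 < p \<Longrightarrow> carrier (Zp p) = {0..<int p}"
  by (simp add: carrier_integer_mod_group)

text \<open>Let a \<open>Zp p\<close>-poset carry a monotone equivariant assignment of families of disjoint sets, all
  of balanced size at least \<open>a\<close>.  Sending \<open>x\<close> to the sign of its family, at the level given by the
  balanced size, is an equivariant order-preserving map to \<open>Qposet\<close>: the level never decreases along
  the order, and where it does not increase the sign pattern is the same by rigidity.  Only
  levels between \<open>a\<close> and the maximal balanced size occur, which bounds the cross-index.\<close>

lemma cross_index_le_balanced_size:
  fixes A :: "'x \<Rightarrow> int \<Rightarrow> 'a set"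
  assumes "prime p" and "finite P" "P \<noteq> {}" and "0 < a"
    and fin: "\<And>x i. x \<in> P \<Longrightarrow> i \<in> {0..<int p} \<Longrightarrow> finite (A x i)"
    and disj: "\<And>x. x \<in> P \<Longrightarrow> disjoint_family_on (A x) {0..<int p}"
    and large: "\<And>x. x \<in> P \<Longrightarrow> a \<le> balanced_size {0..<int p} (A x)"
    and mono: "\<And>x y i. x \<in> P \<Longrightarrow> y \<in> P \<Longrightarrow> leq x y \<Longrightarrow> i \<in> {0..<int p} \<Longrightarrow> A x i \<subseteq> A y i"
    and equiv: "\<And>x g i. x \<in> P \<Longrightarrow> g \<in> {0..<int p} \<Longrightarrow> i \<in> {0..<int p} \<Longrightarrow>
                  A (act g x) i = A x ((i - g) mod int p)"
  shows "\<exists>x\<in>P. cross_index p P leq act + enat a \<le> enat (balanced_size {0..<int p} (A x))"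
proof -
  have p: "0 < p" using prime_gt_0_nat[OF assms(1)] .
  let ?C = "{0..<int p}"
  let ?l = "\<lambda>x. balanced_size ?C (A x)"
  have "Max (?l ` P) \<in> ?l ` P" using assms(2,3) by (intro Max_in) auto
  then obtain z where z: "z \<in> P" "?l z = Max (?l ` P)" by auto
  have le_z: "?l x \<le> ?l z" if "x \<in> P" for x using that z(2) assms(2) by simp
  obtain s :: "(int \<Rightarrow> bool \<times> 'a set) \<Rightarrow> int" where
    s: "\<forall>f. (\<forall>i. f (i + int p) = f i) \<longrightarrow> (\<exists>a b. f a \<noteq> f b) \<longrightarrow>
           s f \<in> ?C \<and> (\<forall>g. s (\<lambda>i. f (i - g)) = (g + s f) mod int p)"
    using equivariant_choice[OF assms(1)] by blast
  have per: "\<forall>i. sign_pattern p B (i + int p) = sign_pattern p B i" for B :: "int \<Rightarrow> 'a set"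
    by (simp add: sign_pattern_def Let_def)
  have nonconst: "\<exists>i j. sign_pattern p (A x) i \<noteq> sign_pattern p (A x) j" if "x \<in> P" for x
    using sign_pattern_nonconstant[OF prime_gt_1_nat[OF assms(1)] disj[OF that]] large[OF that] assms(4)
    by simp
  have s_in: "s (sign_pattern p (A x)) \<in> ?C" if "x \<in> P" for x
    using s per nonconst[OF that] by blast
  have s_shift: "s (\<lambda>i. sign_pattern p (A x) (i - g)) = (g + s (sign_pattern p (A x))) mod int p"
    if "x \<in> P" for x g
    using s[rule_format, OF per[rule_format] nonconst[OF that]] by blast
  \<comment> \<open>The levels of \<open>Qposet\<close> start at 1, so the smallest possible balanced size \<open>a\<close> is sent to 1.\<close>
  define f where "f = (\<lambda>x. (s (sign_pattern p (A x)), Suc (?l x) - a))"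
  have f_le: "Q_le (f x) (f y)" if x: "x \<in> P" and y: "y \<in> P" and xy: "leq x y" for x y
  proof (cases "?l x = ?l y")
    have C: "finite ?C" "?C \<noteq> {}" using p by auto
    note m = balanced_size_mono[of ?C "A y" "A x"]
    case True
    have large_eq: "large_parts ?C (A x) = large_parts ?C (A y)"
      using m(2)[OF C] fin[OF y] mono[OF x y xy] True by blast
    have "A x i = A y i" if "large_parts ?C (A y) = {}" "i \<in> ?C" for i
      using m(3)[OF C] fin[OF y] mono[OF x y xy] True that large_eq by metis
    then have "sign_pattern p (A x) = sign_pattern p (A y)"
      using p by (auto simp: sign_pattern_def Let_def large_eq fun_eq_iff)
    then show ?thesis using True by (simp add: f_def Q_le_def)
  next
    have C: "finite ?C" "?C \<noteq> {}" using p by auto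
    have "?l x \<le> ?l y"
      using balanced_size_mono(1)[OF C] fin[OF y] mono[OF x y xy] by blast
    moreover case False
    ultimately have "?l x < ?l y" by simp
    then have "Suc (?l x) - a < Suc (?l y) - a" using large[OF x] by linarith
    then show ?thesis by (simp add: f_def Q_le_def)
  qed
  have f_in: "f x \<in> Qposet (?l z - a) p" if "x \<in> P" for x
    using large[OF that] le_z[OF that] s_in[OF that] p
    by (auto simp: f_def Qposet_def carrier_Zp)
  have f_act: "f (act g x) = translate p g (f x)" if g: "g \<in> ?C" and x: "x \<in> P" for g x
  proof -
    have "sign_pattern p (A (act g x)) = (\<lambda>i. sign_pattern p (A x) (i - g))"
      by (rule sign_pattern_shift(1)[OF p]) (rule equiv[OF x g])
    moreover have "?l (act g x) = ?l x"
      by (rule sign_pattern_shift(2)[OF p]) (rule equiv[OF x g])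
    ultimately show ?thesis by (simp add: f_def translate_def s_shift[OF x])
  qed
  have "cross_index p P leq act \<le> enat (?l z - a)"
    unfolding cross_index_def
    by (rule Inf_lower) (use f_le f_in f_act p in \<open>auto simp: carrier_Zp intro!: exI[of _ f]\<close>)
  then have "cross_index p P leq act + enat a \<le> enat (?l z - a) + enat a"
    by (rule add_right_mono)
  also have "\<dots> = enat (?l z)" using large[OF z(1)] by simp
  finally show ?thesis using z(1) by blast
qed

section \<open>The index is at most the cross-index of the face poset\<close>

lemma translate_inverse:
  assumes "v \<in> {0..<int p} \<times> UNIV"
  shows "translate p (- g mod int p) (translate p g v) = v"
    and "translate p g (translate p (- g mod int p) v) = v"
  using assms by (auto simp: translate_def mod_simps)

lemma translate_in: "0 < p \<Longrightarrow> translate p g v \<in> {0..<int p} \<times> UNIV"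
  by (simp add: translate_def split: prod.split)

lemma image_translate_inverse:
  assumes "S \<subseteq> {0..<int p} \<times> UNIV"
  shows "translate p (- g mod int p) ` translate p g ` S = S"
    and "translate p g ` translate p (- g mod int p) ` S = S"
proof -
  have S: "v \<in> {0..<int p} \<times> UNIV" if "v \<in> S" for v using assms that by blast
  have "(\<lambda>v. translate p (- g mod int p) (translate p g v)) ` S = (\<lambda>v. v) ` S"
    by (rule image_cong[OF refl]) (rule translate_inverse(1)[OF S])
  then show "translate p (- g mod int p) ` translate p g ` S = S"
    by (simp add: image_image)
  have "(\<lambda>v. translate p g (translate p (- g mod int p) v)) ` S = (\<lambda>v. v) ` S"
    by (rule image_cong[OF refl]) (rule translate_inverse(2)[OF S])
  then show "translate p g ` translate p (- g mod int p) ` S = S"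
    by (simp add: image_image)
qed

text \<open>Translations are injective only on \<open>{0..<int p} \<times> UNIV\<close>, since they reduce the first
  component modulo \<open>p\<close>.  For points supported there, the induced map just permutes coordinates.\<close>

lemma realization_map_translate:
  assumes "0 < p" and supp: "{v. x v \<noteq> 0} \<subseteq> {0..<int p} \<times> UNIV"
  shows "v \<in> {0..<int p} \<times> UNIV \<Longrightarrow> realization_map (translate p g) x (translate p g v) = x v"
    and "w \<notin> {0..<int p} \<times> UNIV \<Longrightarrow> realization_map (translate p g) x w = 0"
proof -
  assume v: "v \<in> {0..<int p} \<times> UNIV"
  have "u = v" if "x u \<noteq> 0" "translate p g u = translate p g v" for u
    using that v supp translate_inverse(1)[of u p g] translate_inverse(1)[of v p g] by auto
  then have "{u. x u \<noteq> 0 \<and> translate p g u = translate p g v} = (if x v = 0 then {} else {v})"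
    by auto
  then show "realization_map (translate p g) x (translate p g v) = x v"
    by (simp add: realization_map_def)
next
  assume "w \<notin> {0..<int p} \<times> UNIV"
  then have "{u. x u \<noteq> 0 \<and> translate p g u = w} = {}"
    using translate_in[OF assms(1)] by blast
  then show "realization_map (translate p g) x w = 0"
    unfolding realization_map_def by (simp only: sum.empty)
qed

text \<open>A continuous stand-in for the barycentric coordinate of the vertex \<open>S\<close> in the barycentric
  subdivision, for nonnegative \<open>x\<close> supported in \<open>N\<close>.  That coordinate is positive iff \<open>S\<close> is a strict superlevel set of \<open>x\<close>, that is, \<open>x\<close>
  is positive on \<open>S\<close> and larger on \<open>S\<close> than on the rest of the vertex set \<open>N\<close>.  The product below is
  positive in exactly the same cases, and after normalisation it serves equally well.\<close>

definition flag_weight :: "'a set \<Rightarrow> 'a set \<Rightarrow> ('a \<Rightarrow> real) \<Rightarrow> real" where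
  "flag_weight N S x = (\<Prod>v\<in>S. x v * (\<Prod>u\<in>N - S. max 0 (x v - x u)))"

lemma flag_weight_nonneg: "(\<And>v. 0 \<le> x v) \<Longrightarrow> 0 \<le> flag_weight N S x"
  by (auto simp: flag_weight_def intro!: prod_nonneg mult_nonneg_nonneg)

lemma flag_weight_nonzero_iff:
  assumes "finite N" "S \<subseteq> N"
  shows "flag_weight N S x \<noteq> 0 \<longleftrightarrow> (\<forall>v\<in>S. x v \<noteq> 0 \<and> (\<forall>u\<in>N - S. x u < x v))"
proof -
  have "finite S" using assms finite_subset by blast
  moreover have "max 0 (x v - x u) = 0 \<longleftrightarrow> \<not> x u < x v" for u v by auto
  ultimately show ?thesis using assms(1) by (auto simp: flag_weight_def)
qed

text \<open>Superlevel sets of one function are nested.\<close>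

lemma flag_weight_chain:
  assumes "finite N" "S \<subseteq> N" "T \<subseteq> N" "flag_weight N S x \<noteq> 0" "flag_weight N T x \<noteq> 0"
  shows "S \<subseteq> T \<or> T \<subseteq> S"
proof (rule ccontr)
  assume "\<not> ?thesis"
  then obtain a b where "a \<in> S" "a \<notin> T" "b \<in> T" "b \<notin> S" by auto
  then have "x b < x a" "x a < x b"
    using assms(4,5) assms(2,3) unfolding flag_weight_nonzero_iff[OF assms(1,2)]
      flag_weight_nonzero_iff[OF assms(1,3)] by auto
  then show False by simp
qed

lemma continuous_flag_weight: "continuous_on A (flag_weight N S)"
proof -
  have coord: "continuous_on A (\<lambda>x :: 'a \<Rightarrow> real. x v)" for v
    by (rule continuous_on_subset[OF continuous_on_product_coordinates]) simp
  show ?thesis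
    unfolding flag_weight_def[abs_def]
    by (intro continuous_on_prod continuous_on_mult continuous_on_max continuous_on_const
        continuous_on_diff coord)
qed

lemma flag_weight_image:
  assumes "inj_on t N" "t ` N = N" "S \<subseteq> N" and "\<And>v. v \<in> N \<Longrightarrow> y (t v) = x v"
  shows "flag_weight N (t ` S) y = flag_weight N S x"
proof -
  have "N - t ` S = t ` (N - S)"
    using assms(1-3) by (metis Diff_subset inj_on_image_set_diff subset_refl)
  moreover have "inj_on t S" "inj_on t (N - S)"
    using assms(1,3) by (auto intro: inj_on_subset)
  moreover have "y (t v) = x v" if "v \<in> S" for v
    using assms(3,4) that by auto
  ultimately show ?thesis
    using assms(4) by (simp add: flag_weight_def prod.reindex)
qed

text \<open>An order-preserving equivariant map \<open>f\<close> from the simplices of \<open>K\<close> to \<open>Qposet n p\<close> is an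
  equivariant simplicial map from the barycentric subdivision of \<open>K\<close> to \<open>EnZp n p\<close>, because two
  comparable elements of \<open>Qposet n p\<close> at the same level are equal.  Its affine extension is a
  continuous equivariant map of realizations.  The proof uses the variant of this extension in which
  the normalised flag weights replace the barycentric coordinates of the subdivision.\<close>

lemma complex_index_le_cross_index:
  fixes K :: "(int \<times> 'v) set set"
  assumes p: "0 < p" and "finite X"
    and K: "\<And>S. S \<in> K \<Longrightarrow> S \<subseteq> carrier (Zp p) \<times> X"
    and K_act: "\<And>g S. g \<in> carrier (Zp p) \<Longrightarrow> S \<in> K \<Longrightarrow> translate p g ` S \<in> K"
  shows "complex_index p K (translate p) \<le> cross_index p K (\<subseteq>) (\<lambda>g. (`) (translate p g))"
proof -
  let ?C = "{0..<int p}"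
  let ?N = "?C \<times> X"
  note C = carrier_Zp[OF p]
  have finN: "finite ?N" using assms(2) by simp
  have KN: "S \<subseteq> ?N" if "S \<in> K" for S using K[OF that] C by simp
  have finK: "finite K" using finite_subset[of K "Pow ?N"] KN finN by auto
  have neg: "- g mod int p \<in> ?C" for g using p by simp
  have geometric: "\<exists>F. continuous_map (realization_topology K) (realization_topology (EnZp n p)) F \<and>
      (\<forall>g\<in>carrier (Zp p). \<forall>x\<in>topspace (realization_topology K).
         F (realization_map (translate p g) x) = realization_map (translate p g) (F x))"
    if f_in: "f \<in> K \<rightarrow> Qposet n p"
      and f_le: "\<forall>S\<in>K. \<forall>T\<in>K. S \<subseteq> T \<longrightarrow> Q_le (f S) (f T)"
      and f_act: "\<forall>g\<in>carrier (Zp p). \<forall>S\<in>K. f (translate p g ` S) = translate p g (f S)"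
    for f n
  proof -
    define total where "total = (\<lambda>x. \<Sum>S\<in>K. flag_weight ?N S x)"
    define F where "F = (\<lambda>x w. (\<Sum>S | S \<in> K \<and> f S = w. flag_weight ?N S x) / total x)"
    have nonneg: "0 \<le> flag_weight ?N S x" if "x \<in> realization K" for S x
      using that unfolding realization_def by (intro flag_weight_nonneg) blast
    have total_pos: "0 < total x" if x: "x \<in> realization K" for x
    proof -
      let ?S = "{v. x v \<noteq> 0}"
      have S: "?S \<in> K" and x0: "\<And>v. 0 \<le> x v" using x unfolding realization_def by blast+
      have less: "x u < x v" if "x v \<noteq> 0" "x u = 0" for u v using that x0[of v] by simp
      \<comment> \<open>The support of \<open>x\<close> is itself a superlevel set and a simplex of \<open>K\<close>.\<close>
      have "flag_weight ?N ?S x \<noteq> 0"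
        unfolding flag_weight_nonzero_iff[OF finN KN[OF S]]
        using less by blast
      then have "0 < flag_weight ?N ?S x" using nonneg[OF x, of ?S] by simp
      also have "\<dots> \<le> total x"
        unfolding total_def using finK S nonneg[OF x] by (intro member_le_sum) auto
      finally show ?thesis .
    qed
    have support: "\<exists>S\<in>K. f S = w \<and> flag_weight ?N S x \<noteq> 0" if "F x w \<noteq> 0" for x w
    proof (rule ccontr)
      assume "\<not> ?thesis"
      then have "(\<Sum>S | S \<in> K \<and> f S = w. flag_weight ?N S x) = 0"
        by (intro sum.neutral) auto
      then show False using that by (simp add: F_def)
    qed
    have f_C: "f S \<in> ?C \<times> {1..n+1}" if "S \<in> K" for S
      using f_in that C by (auto simp: Qposet_def)
    have f_img: "f ` K \<subseteq> ?C \<times> {1..n+1}" using f_C by (rule image_subsetI)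
    have F_supp: "{w. F x w \<noteq> 0} \<subseteq> f ` K" for x
      using support by blast
    have F_in: "F x \<in> realization (EnZp n p)" if x: "x \<in> realization K" for x
    proof -
      have "0 \<le> F x w" for w
        unfolding F_def using nonneg[OF x] total_pos[OF x]
        by (intro divide_nonneg_pos sum_nonneg) auto
      moreover have F_sum: "(\<Sum>w | F x w \<noteq> 0. F x w) = 1"
      proof -
        have "(\<Sum>w | F x w \<noteq> 0. F x w) = (\<Sum>w\<in>f ` K. F x w)"
          using finK F_supp by (intro sum.mono_neutral_left) auto
        also have "\<dots> = (\<Sum>w\<in>f ` K. \<Sum>S | S \<in> K \<and> f S = w. flag_weight ?N S x) / total x"
          by (simp add: F_def sum_divide_distrib)
        also have "\<dots> = total x / total x"
          unfolding total_def using finK by (subst sum.image_gen[symmetric]) auto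
        also have "\<dots> = 1" using total_pos[OF x] by simp
        finally show ?thesis .
      qed
      moreover have "{w. F x w \<noteq> 0} \<in> EnZp n p"
      proof -
        have "{w. F x w \<noteq> 0} \<noteq> {}" using F_sum by (metis sum.empty zero_neq_one)
        moreover have "{w. F x w \<noteq> 0} \<subseteq> carrier (Zp p) \<times> {1..n+1}"
          unfolding C by (rule order_trans[OF F_supp f_img])
        moreover have "inj_on snd {w. F x w \<noteq> 0}"
        proof (rule inj_onI)
          fix a b assume a: "a \<in> {w. F x w \<noteq> 0}" and b: "b \<in> {w. F x w \<noteq> 0}"
            and eq: "snd a = snd b"
          obtain S where S: "S \<in> K" "f S = a" "flag_weight ?N S x \<noteq> 0"
            using support[of x a] a by blast
          obtain T where T: "T \<in> K" "f T = b" "flag_weight ?N T x \<noteq> 0"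
            using support[of x b] b by blast
          have "S \<subseteq> T \<or> T \<subseteq> S"
            using flag_weight_chain[OF finN KN[OF S(1)] KN[OF T(1)] S(3) T(3)] .
          then have "Q_le a b \<or> Q_le b a" using f_le S(1,2) T(1,2) by blast
          then show "a = b" using eq by (auto simp: Q_le_def)
        qed
        ultimately show ?thesis by (simp add: EnZp_def)
      qed
      ultimately show ?thesis by (simp add: realization_def)
    qed
    have cont: "continuous_on (realization K) F"
    proof (rule continuous_on_coordinatewise_then_product)
      fix w
      have "continuous_on (realization K) total"
        unfolding total_def by (intro continuous_intros continuous_flag_weight)
      moreover have "\<forall>x\<in>realization K. total x \<noteq> 0"
        using total_pos by force
      ultimately show "continuous_on (realization K) (\<lambda>x. F x w)"
        unfolding F_def by (intro continuous_intros continuous_flag_weight) auto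
    qed
    have equiv: "F (realization_map (translate p g) x) = realization_map (translate p g) (F x)"
      if g: "g \<in> ?C" and x: "x \<in> realization K" for g x
    proof
      fix w
      let ?t = "translate p g" and ?t' = "translate p (- g mod int p) :: int \<times> 'v \<Rightarrow> int \<times> 'v"
      let ?y = "realization_map ?t x"
      have x_supp: "{v. x v \<noteq> 0} \<subseteq> ?C \<times> UNIV"
        using x KN by (fastforce simp: realization_def)
      have t_bij: "bij_betw ?t ?N ?N"
        by (rule bij_betw_byWitness[where f' = ?t'])
          (use translate_inverse p in \<open>auto simp: translate_def\<close>)
      have weight: "flag_weight ?N (?t ` S) ?y = flag_weight ?N S x" if "S \<in> K" for S
        using t_bij KN[OF that] realization_map_translate(1)[OF p x_supp]
        by (intro flag_weight_image) (auto simp: bij_betw_def)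
      have K_inv: "?t' ` ?t ` S = S" "?t ` ?t' ` S = S" "?t ` S \<in> K" "?t' ` S \<in> K"
        if "S \<in> K" for S
      proof -
        have "S \<subseteq> ?C \<times> UNIV" using KN[OF that] by auto
        then show "?t' ` ?t ` S = S" "?t ` ?t' ` S = S"
          by (rule image_translate_inverse)+
        show "?t ` S \<in> K" "?t' ` S \<in> K" using K_act that C g neg by auto
      qed
      have K_bij: "bij_betw ((`) ?t) K K"
        by (rule bij_betw_byWitness[where f' = "(`) ?t'"]) (use K_inv in auto)
      have total_eq: "total ?y = total x"
      proof -
        have "total ?y = (\<Sum>S\<in>K. flag_weight ?N (?t ` S) ?y)"
          unfolding total_def by (rule sum.reindex_bij_betw[OF K_bij, symmetric])
        also have "\<dots> = total x"
          unfolding total_def by (rule sum.cong[OF refl]) (rule weight)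
        finally show ?thesis .
      qed
      have F_supp': "{v. F x v \<noteq> 0} \<subseteq> ?C \<times> UNIV"
        by (rule order_trans[OF order_trans[OF F_supp f_img]]) auto
      show "F ?y w = realization_map (translate p g) (F x) w"
      proof (cases "w \<in> ?C \<times> UNIV")
        case True
        define v where "v = translate p (- g mod int p) w"
        have w: "w = translate p g v" using translate_inverse(2)[OF True] by (simp add: v_def)
        have v: "v \<in> ?C \<times> UNIV" unfolding v_def by (rule translate_in[OF p])
        have f_iff: "f (?t ` S) = w \<longleftrightarrow> f S = v" if "S \<in> K" for S
        proof -
          have "f S \<in> ?C \<times> UNIV" using f_C[OF that] by auto
          then have "translate p g (f S) = translate p g v \<longleftrightarrow> f S = v"
            using translate_inverse(1)[of "f S" p g] translate_inverse(1)[OF v, of g] by metis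
          then show ?thesis using f_act that g C w by simp
        qed
        have "bij_betw ((`) ?t) {S. S \<in> K \<and> f S = v} {S. S \<in> K \<and> f S = w}"
        proof (rule bij_betw_byWitness[where f' = "(`) ?t'"])
          show "(`) ?t ` {S. S \<in> K \<and> f S = v} \<subseteq> {S. S \<in> K \<and> f S = w}"
            using K_inv(3) f_iff by auto
          show "(`) ?t' ` {S. S \<in> K \<and> f S = w} \<subseteq> {S. S \<in> K \<and> f S = v}"
          proof
            fix T assume "T \<in> (`) ?t' ` {S. S \<in> K \<and> f S = w}"
            then obtain S where "S \<in> K" "f S = w" "T = ?t' ` S" by auto
            then show "T \<in> {S. S \<in> K \<and> f S = v}"
              using K_inv(2,4)[of S] f_iff[of "?t' ` S"] by simp
          qed
        qed (use K_inv(1,2) in auto)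
        then have "(\<Sum>S | S \<in> K \<and> f S = w. flag_weight ?N S ?y) =
            (\<Sum>S | S \<in> K \<and> f S = v. flag_weight ?N (?t ` S) ?y)"
          by (rule sum.reindex_bij_betw[symmetric])
        also have "\<dots> = (\<Sum>S | S \<in> K \<and> f S = v. flag_weight ?N S x)"
          by (rule sum.cong) (auto simp: weight)
        finally have "F ?y w = F x v" by (simp add: F_def total_eq)
        then show ?thesis using realization_map_translate(1)[OF p F_supp' v, of g] w by simp
      next
        case False
        then have "{S. S \<in> K \<and> f S = w} = {}" using f_C by force
        then have "F ?y w = 0" unfolding F_def by (simp only: sum.empty div_0)
        then show ?thesis using realization_map_translate(2)[OF p F_supp' False, of g] by simp
      qed
    qed
    show ?thesis
      using cont F_in equiv C by (intro exI[of _ F]) (auto simp: realization_topology_def)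
  qed
  then show ?thesis
    unfolding complex_index_def space_index_def cross_index_def
    by (intro Inf_superset_mono Collect_mono impI)
      (elim exE conjE, rule exI, rule conjI, assumption, rule geometric; assumption)
qed

section \<open>Multicolored complete multipartite subgraphs\<close>

lemma cross_pairs_mono:
  assumes "inj_on \<pi> I" "\<pi> ` I \<subseteq> J" "\<And>i. i \<in> I \<Longrightarrow> U i \<subseteq> W (\<pi> i)"
  shows "cross_pairs I U \<subseteq> cross_pairs J W"
proof
  fix e assume "e \<in> cross_pairs I U"
  then obtain u v i j where e: "e = {u, v}" and ij: "i \<in> I" "j \<in> I" "i \<noteq> j"
    and uv: "u \<in> U i" "v \<in> U j"
    by (auto simp: cross_pairs_def)
  have "\<pi> i \<in> J" "\<pi> j \<in> J" "\<pi> i \<noteq> \<pi> j"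
    using assms(1,2) ij by (auto dest: inj_onD)
  moreover have "u \<in> W (\<pi> i)" "v \<in> W (\<pi> j)" using assms(3) ij uv by auto
  ultimately show "e \<in> cross_pairs J W" unfolding cross_pairs_def e by blast
qed

lemma complete_multipartite_mono:
  assumes "complete_multipartite E J W" "inj_on \<pi> I" "\<pi> ` I \<subseteq> J"
    "\<And>i. i \<in> I \<Longrightarrow> U i \<subseteq> W (\<pi> i)"
  shows "complete_multipartite E I U"
  using cross_pairs_mono[of \<pi> I J U W] assms by (auto simp: complete_multipartite_def)

lemma colors_differ_across_parts:
  assumes "proper_coloring E c" "complete_multipartite E I U"
    and "i \<in> I" "j \<in> I" "i \<noteq> j" "u \<in> U i" "v \<in> U j"
  shows "c u \<noteq> c v"
proof -
  have "{u, v} \<in> cross_pairs I U" using assms(3-7) by (auto simp: cross_pairs_def)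
  then have "{u, v} \<in> E" using assms(2) by (auto simp: complete_multipartite_def)
  then show ?thesis using assms(1) by (simp add: proper_coloring_def)
qed

lemma colors_disjoint:
  assumes "proper_coloring E c" "complete_multipartite E I U"
  shows "disjoint_family_on (\<lambda>i. c ` U i) I"
proof -
  have "c ` U i \<inter> c ` U j = {}" if "i \<in> I" "j \<in> I" "i \<noteq> j" for i j
    using colors_differ_across_parts[OF assms that] by blast
  then show ?thesis by (simp add: disjoint_family_on_def)
qed

text \<open>The color sets of the parts are disjoint, so choosing one vertex for each color of
  a balanced subfamily of the color sets gives a multicolored balanced subgraph.\<close>

lemma multicolored_subgraph_exists:
  assumes G: "is_graph V E" and c: "proper_coloring E c" and "0 < p"
    and U: "\<And>i. i \<in> {0..<int p} \<Longrightarrow> U i \<subseteq> V"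
    and complete: "complete_multipartite E {0..<int p} U"
    and s: "s \<le> balanced_size {0..<int p} (\<lambda>i. c ` U i)"
  shows "\<exists>n W F. is_subgraph W F V E \<and> multicolored c W \<and>
           is_complete_multipartite_graph p n W F \<and> (\<Sum>i=1..p. n i) = s \<and>
           (\<forall>i\<in>{1..p}. \<forall>j\<in>{1..p}. \<bar>int (n i) - int (n j)\<bar> \<le> 1)"
proof -
  let ?C = "{0..<int p}"
  have C: "finite ?C" "?C \<noteq> {}" using assms(3) by auto
  obtain n where n_sum: "sum n ?C = s" and n_le: "\<And>i. i \<in> ?C \<Longrightarrow> n i \<le> card (c ` U i)"
    and n_bal: "\<And>i j. i \<in> ?C \<Longrightarrow> j \<in> ?C \<Longrightarrow> \<bar>int (n i) - int (n j)\<bar> \<le> 1"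
    using balanced_profile_exists[OF C s] by metis
  have "\<exists>W. W \<subseteq> U i \<and> inj_on c W \<and> card W = n i" if i: "i \<in> ?C" for i
  proof -
    obtain B where B: "B \<subseteq> c ` U i" "card B = n i"
      using n_le[OF i] by (meson obtain_subset_with_card_n)
    then obtain W where "W \<subseteq> U i" "inj_on c W" "B = c ` W"
      by (auto simp: subset_image_inj)
    then show ?thesis using B(2) card_image by metis
  qed
  then have "\<forall>i\<in>?C. \<exists>W. W \<subseteq> U i \<and> inj_on c W \<and> card W = n i" by blast
  from bchoice[OF this] obtain W
    where W': "\<forall>i\<in>?C. W i \<subseteq> U i \<and> inj_on c (W i) \<and> card (W i) = n i" by blast
  then have W: "W i \<subseteq> U i" "inj_on c (W i)" "card (W i) = n i" if "i \<in> ?C" for i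
    using that by blast+
  \<comment> \<open>Parts of a complete multipartite graph may be numbered in any order, so \<open>1..p\<close> is matched with
    the residues by a shift that ignores the group structure.\<close>
  define \<pi> where "\<pi> = (\<lambda>k::nat. int k - 1)"
  have \<pi>_bij: "bij_betw \<pi> {1..p} ?C"
    unfolding \<pi>_def by (rule bij_betw_byWitness[where f' = "\<lambda>i. nat (i + 1)"]) auto
  then have \<pi>_inj: "inj_on \<pi> {1..p}" and \<pi>_C: "\<And>k. k \<in> {1..p} \<Longrightarrow> \<pi> k \<in> ?C"
    by (auto simp: bij_betw_def)
  define X where "X = (\<lambda>k. W (\<pi> k))"
  have X: "X k \<subseteq> V" "inj_on c (X k)" "card (X k) = n (\<pi> k)" if "k \<in> {1..p}" for k
    using W[OF \<pi>_C[OF that]] U[OF \<pi>_C[OF that]] by (auto simp: X_def)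
  have "finite V" using G by (simp add: is_graph_def)
  then have X_fin: "finite (X k)" if "k \<in> {1..p}" for k
    using X(1)[OF that] finite_subset by blast
  have X_complete: "complete_multipartite E {1..p} X"
    using \<pi>_C W(1) by (intro complete_multipartite_mono[OF complete \<pi>_inj]) (auto simp: X_def)
  note differ = colors_differ_across_parts[OF c X_complete]
  define Y where "Y = (\<Union>k\<in>{1..p}. X k)"
  have Y_V: "Y \<subseteq> V" unfolding Y_def by (rule UN_least) (rule X(1))
  have "cross_pairs {1..p} X \<subseteq> [Y]\<^bsup>2\<^esup>"
  proof
    fix e assume "e \<in> cross_pairs {1..p} X"
    then obtain u v i j where e: "e = {u, v}" and ij: "i \<in> {1..p}" "j \<in> {1..p}" "i \<noteq> j"
      and uv: "u \<in> X i" "v \<in> X j"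
      unfolding cross_pairs_def by blast
    have "u \<noteq> v" using differ[OF ij uv] by auto
    moreover have "u \<in> Y" "v \<in> Y" using ij uv unfolding Y_def by blast+
    ultimately show "e \<in> [Y]\<^bsup>2\<^esup>" by (simp add: e nsets_def)
  qed
  then have "is_subgraph Y (cross_pairs {1..p} X) V E"
    using Y_V finite_subset[OF Y_V \<open>finite V\<close>] X_complete
    by (simp add: is_subgraph_def is_graph_def complete_multipartite_def)
  moreover have "multicolored c Y"
    unfolding multicolored_def
  proof (rule inj_onI)
    fix u v assume "u \<in> Y" "v \<in> Y" and eq: "c u = c v"
    then obtain i j where ij: "i \<in> {1..p}" "j \<in> {1..p}" "u \<in> X i" "v \<in> X j"
      unfolding Y_def by blast
    then have "i = j" using differ eq by blast
    then show "u = v" using X(2)[OF ij(1)] ij eq by (auto dest: inj_onD)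
  qed
  moreover have "is_complete_multipartite_graph p (\<lambda>k. n (\<pi> k)) Y (cross_pairs {1..p} X)"
  proof -
    have "X i \<inter> X j = {}" if "i \<in> {1..p}" "j \<in> {1..p}" "i \<noteq> j" for i j
      using differ[OF that] by blast
    then have "disjoint_family_on X {1..p}" by (simp add: disjoint_family_on_def)
    then show ?thesis
      unfolding is_complete_multipartite_graph_def using X_fin X(3) Y_def by blast
  qed
  moreover have "(\<Sum>k=1..p. n (\<pi> k)) = s"
    using sum.reindex_bij_betw[OF \<pi>_bij, of n] n_sum by simp
  moreover have "\<forall>i\<in>{1..p}. \<forall>j\<in>{1..p}. \<bar>int (n (\<pi> i)) - int (n (\<pi> j))\<bar> \<le> 1"
    using n_bal \<pi>_C by blast
  ultimately show ?thesis
    by (intro exI[of _ "\<lambda>k. n (\<pi> k)"] exI[of _ Y] exI[of _ "cross_pairs {1..p} X"]) blast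
qed

section \<open>The box complex and the Hom complex\<close>

text \<open>A simplex of the box complex is determined as a set of signed vertices by its fibres, which
  are the parts \<open>U i\<close>; this makes translation and inclusion easy to follow.\<close>

lemma box_complex_iff:
  assumes "0 < p"
  shows "S \<in> box_complex p V E \<longleftrightarrow>
    S \<subseteq> {0..<int p} \<times> V \<and> S \<noteq> {} \<and> disjoint_family_on (\<lambda>i. S `` {i}) {0..<int p} \<and>
    complete_multipartite E {0..<int p} (\<lambda>i. S `` {i})"
    (is "_ \<longleftrightarrow> ?R")
proof
  let ?C = "{0..<int p}"
  note C = carrier_Zp[OF assms]
  show ?R if S_box: "S \<in> box_complex p V E"
  proof -
    obtain U where S: "S = Sigma ?C U" and U: "\<forall>i\<in>?C. U i \<subseteq> V" "disjoint_family_on U ?C"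
      "(\<Union>i\<in>?C. U i) \<noteq> {}" "complete_multipartite E ?C U"
      using S_box unfolding box_complex_def C by blast
    have fibre: "S `` {i} = U i" if "i \<in> ?C" for i using that by (auto simp: S)
    have "complete_multipartite E ?C (\<lambda>i. S `` {i})"
      by (rule complete_multipartite_mono[OF U(4) inj_on_id]) (auto simp: fibre)
    moreover have "disjoint_family_on (\<lambda>i. S `` {i}) ?C"
      using U(2) fibre by (simp add: disjoint_family_on_def)
    ultimately show ?thesis using U(1,3) unfolding S by blast
  qed
  show "S \<in> box_complex p V E" if R: ?R
  proof -
    have "S = Sigma ?C (\<lambda>i. S `` {i})" using R by auto
    moreover have "\<forall>i\<in>?C. S `` {i} \<subseteq> V" using R by auto
    moreover have "(\<Union>i\<in>?C. S `` {i}) \<noteq> {}" using R by fastforce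
    ultimately show ?thesis unfolding box_complex_def C using R by blast
  qed
qed

lemma translate_fibre:
  assumes "0 < p" "S \<subseteq> {0..<int p} \<times> UNIV" "i \<in> {0..<int p}"
  shows "(translate p g ` S) `` {i} = S `` {(i - g) mod int p}"
proof -
  have "(i, v) \<in> translate p g ` S \<longleftrightarrow> ((i - g) mod int p, v) \<in> S" for v
  proof
    assume "(i, v) \<in> translate p g ` S"
    then obtain h where h: "(h, v) \<in> S" "i = (g + h) mod int p" by (auto simp: translate_def)
    then have "(i - g) mod int p = h" using assms(2) by (auto simp: mod_simps)
    then show "((i - g) mod int p, v) \<in> S" using h(1) by simp
  next
    assume "((i - g) mod int p, v) \<in> S"
    moreover have "translate p g ((i - g) mod int p, v) = (i, v)"
      using assms(3) by (simp add: translate_def mod_simps)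
    ultimately show "(i, v) \<in> translate p g ` S" by (metis image_eqI)
  qed
  then show ?thesis by blast
qed

lemma translate_box_complex:
  assumes "0 < p" "S \<in> box_complex p V E"
  shows "translate p g ` S \<in> box_complex p V E"
proof -
  let ?C = "{0..<int p}"
  let ?T = "translate p g ` S"
  note S = assms(2)[unfolded box_complex_iff[OF assms(1)]]
  have p: "0 < int p" using assms(1) by simp
  have fibre: "?T `` {i} = S `` {(i - g) mod int p}" if "i \<in> ?C" for i
    using S that by (intro translate_fibre[OF assms(1)]) auto
  have inj: "inj_on (\<lambda>i. (i - g) mod int p) ?C" and im: "(\<lambda>i. (i - g) mod int p) ` ?C \<subseteq> ?C"
    using bij_betw_shift_mod[OF p, of g] by (simp_all add: bij_betw_def)
  have "complete_multipartite E ?C (\<lambda>i. ?T `` {i})"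
    by (rule complete_multipartite_mono[OF _ inj im, where W = "\<lambda>i. S `` {i}"]) (use S fibre in auto)
  moreover have "disjoint_family_on (\<lambda>i. ?T `` {i}) ?C"
  proof -
    have "?T `` {i} \<inter> ?T `` {j} = {}" if ij: "i \<in> ?C" "j \<in> ?C" "i \<noteq> j" for i j
    proof -
      have "(i - g) mod int p \<noteq> (j - g) mod int p" using inj ij by (auto dest: inj_onD)
      moreover have "(i - g) mod int p \<in> ?C" "(j - g) mod int p \<in> ?C" using p by auto
      ultimately show ?thesis
        using S fibre[OF ij(1)] fibre[OF ij(2)] unfolding disjoint_family_on_def by metis
    qed
    then show ?thesis by (simp add: disjoint_family_on_def)
  qed
  moreover have "?T \<subseteq> ?C \<times> V" using S p by (auto simp: translate_def)
  ultimately show ?thesis unfolding box_complex_iff[OF assms(1)] using S by simp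
qed

text \<open>Every simplex is nonempty and so has balanced size at least 1, which is the summand 1.\<close>

lemma ind_box_le_balanced_size:
  assumes "prime p" "is_graph V E" "V \<noteq> {}" "proper_coloring E c"
  shows "\<exists>S\<in>box_complex p V E.
    ind_box p V E + 1 \<le> enat (balanced_size {0..<int p} (\<lambda>i. c ` (S `` {i})))"
proof -
  let ?C = "{0..<int p}" and ?K = "box_complex p V E"
  have p: "0 < p" using prime_gt_0_nat[OF assms(1)] .
  have finV: "finite V" using assms(2) by (simp add: is_graph_def)
  note iff = box_complex_iff[OF p, of _ V E]
  have K_sub: "S \<subseteq> ?C \<times> V" if "S \<in> ?K" for S using that by (simp add: iff)
  have "finite ?K" by (rule finite_subset[of _ "Pow (?C \<times> V)"]) (use K_sub finV in auto)
  moreover have "?K \<noteq> {}"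
  proof -
    obtain v where "v \<in> V" using assms(3) by auto
    then have "{(0, v)} \<in> ?K"
      using p by (auto simp: iff disjoint_family_on_def complete_multipartite_def cross_pairs_def)
    then show ?thesis by auto
  qed
  moreover have fin: "finite (c ` (S `` {i}))" if "S \<in> ?K" for S i
  proof -
    have "finite S" using K_sub[OF that] finV by (auto intro: finite_subset)
    then show ?thesis by simp
  qed
  moreover have "disjoint_family_on (\<lambda>i. c ` (S `` {i})) ?C" if "S \<in> ?K" for S
    using that by (intro colors_disjoint[OF assms(4)]) (simp add: iff)
  moreover have "1 \<le> balanced_size ?C (\<lambda>i. c ` (S `` {i}))" if S: "S \<in> ?K" for S
  proof -
    obtain i v where iv: "(i, v) \<in> S" using S by (force simp: iff)
    then have "i \<in> ?C" using K_sub[OF S] by auto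
    then have "0 < balanced_size ?C (\<lambda>i. c ` (S `` {i}))"
      using iv fin[OF S] by (intro balanced_size_pos[of _ i]) auto
    then show ?thesis by simp
  qed
  moreover have "c ` ((translate p g ` S) `` {i}) = c ` (S `` {(i - g) mod int p})"
    if "S \<in> ?K" "i \<in> ?C" for S g i
    using K_sub[OF that(1)] that(2) translate_fibre[OF p, of S i g] by auto
  ultimately have "\<exists>S\<in>?K. cross_index p ?K (\<subseteq>) (\<lambda>g. (`) (translate p g)) + enat 1
      \<le> enat (balanced_size ?C (\<lambda>i. c ` (S `` {i})))"
    by (intro cross_index_le_balanced_size[OF assms(1)]) auto
  moreover have "ind_box p V E \<le> cross_index p ?K (\<subseteq>) (\<lambda>g. (`) (translate p g))"
    unfolding ind_box_def
    by (rule complex_index_le_cross_index[OF p finV])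
      (use K_sub translate_box_complex[OF p] carrier_Zp[OF p] in auto)
  ultimately show ?thesis
    by (metis add_right_mono one_enat_def order_trans)
qed

lemma Hom_complex_nonempty:
  assumes "finite V" "p \<le> clique_number V E" "0 < p"
  shows "Hom_complex p V E \<noteq> {}"
proof -
  let ?C = "{0..<int p}"
  let ?sizes = "{card K | K. K \<subseteq> V \<and> clique K E}"
  have "?sizes \<subseteq> card ` Pow V" by auto
  then have "finite ?sizes" using assms(1) finite_subset by blast
  moreover have "?sizes \<noteq> {}" by (auto intro!: exI[of _ "{}"] simp: clique_def)
  ultimately have "clique_number V E \<in> ?sizes" unfolding clique_number_def by (rule Max_in)
  then obtain K where K: "K \<subseteq> V" "clique K E" "p \<le> card K" using assms(2) by auto
  have "finite K" using K(1) assms(1) finite_subset by blast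
  moreover have "card ?C \<le> card K" using K(3) by simp
  ultimately obtain b where b: "b ` ?C \<subseteq> K" "inj_on b ?C"
    using card_le_inj[of ?C K] by auto
  define U where "U = (\<lambda>i\<in>?C. {b i})"
  have "U \<in> ?C \<rightarrow>\<^sub>E Pow V - {{}}" using b(1) K(1) by (auto simp: U_def)
  moreover have "disjoint_family_on U ?C"
    using b(2) by (auto simp: U_def disjoint_family_on_def dest: inj_onD)
  moreover have "complete_multipartite E ?C U"
  proof -
    have "{b i, b j} \<in> E" if "i \<in> ?C" "j \<in> ?C" "i \<noteq> j" for i j
    proof -
      have "b i \<noteq> b j" using b(2) that by (auto dest: inj_onD)
      then show ?thesis using K(2) b(1) that unfolding clique_def by blast
    qed
    then show ?thesis by (auto simp: complete_multipartite_def cross_pairs_def U_def)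
  qed
  ultimately show ?thesis unfolding Hom_complex_def carrier_Zp[OF assms(3)] by blast
qed

text \<open>All \<open>p\<close> parts of an element of the Hom complex are nonempty, so every balanced size is at
  least \<open>p\<close>, which is the summand \<open>p\<close>.\<close>

lemma Xind_Hom_le_balanced_size:
  assumes "prime p" "is_graph V E" "proper_coloring E c" "p \<le> clique_number V E"
  shows "\<exists>U. (\<forall>i\<in>{0..<int p}. U i \<subseteq> V) \<and> complete_multipartite E {0..<int p} U \<and>
    Xind_Hom p V E + enat p \<le> enat (balanced_size {0..<int p} (\<lambda>i. c ` U i))"
proof -
  let ?C = "{0..<int p}" and ?H = "Hom_complex p V E"
  have p: "0 < p" using prime_gt_0_nat[OF assms(1)] .
  have C: "finite ?C" "?C \<noteq> {}" "card ?C = p" using p by auto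
  have finV: "finite V" using assms(2) by (simp add: is_graph_def)
  \<comment> \<open>The group acts on the Hom complex by \<open>i \<mapsto> i + g\<close> on indices, but on the fibres of
    simplices of the box complex by \<open>i \<mapsto> i - g\<close>.  Reversing the indices turns the former into the
    latter.\<close>
  define rev where "rev = (\<lambda>U :: int \<Rightarrow> 'a set. \<lambda>i. U (- i mod int p))"
  have neg_C: "- i mod int p \<in> ?C" for i using p by simp
  have neg_inj: "inj_on (\<lambda>i. - i mod int p) ?C"
    by (rule inj_on_inverseI[where g = "\<lambda>i. - i mod int p"]) (simp add: mod_minus_eq)
  have H: "U i \<subseteq> V" "U i \<noteq> {}" if "U \<in> ?H" "i \<in> ?C" for U i
    using that unfolding Hom_complex_def carrier_Zp[OF p] by (auto dest: PiE_mem)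
  have rev_sub: "rev U i \<subseteq> V" and rev_ne: "rev U i \<noteq> {}" if "U \<in> ?H" for U i
    using H[OF that neg_C] by (auto simp: rev_def)
  have complete: "complete_multipartite E ?C (rev U)" if "U \<in> ?H" for U
  proof (rule complete_multipartite_mono[OF _ neg_inj])
    show "complete_multipartite E ?C U"
      using that by (simp add: Hom_complex_def carrier_Zp[OF p])
  qed (use neg_C in \<open>auto simp: rev_def\<close>)
  have fin: "finite (c ` rev U i)" if "U \<in> ?H" for U i
    using rev_sub[OF that] finV finite_subset by blast
  have "?H \<subseteq> ?C \<rightarrow>\<^sub>E Pow V - {{}}" by (auto simp: Hom_complex_def carrier_Zp[OF p])
  moreover have "finite (?C \<rightarrow>\<^sub>E Pow V - {{}})" using finV by (intro finite_PiE) auto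
  ultimately have "finite ?H" by (rule finite_subset)
  moreover have "?H \<noteq> {}" by (rule Hom_complex_nonempty[OF finV assms(4) p])
  moreover have "p \<le> balanced_size ?C (\<lambda>i. c ` rev U i)" if "U \<in> ?H" for U
    using card_le_balanced_size[OF C(1,2), of "\<lambda>i. c ` rev U i"] fin[OF that] rev_ne[OF that] C(3)
    by simp
  moreover have "c ` rev U i \<subseteq> c ` rev U' i" if "Hom_le p U U'" for U U' i
    using that neg_C[of i] unfolding Hom_le_def carrier_Zp[OF p] rev_def by (intro image_mono) blast
  moreover have "c ` rev (Hom_act p g U) i = c ` rev U ((i - g) mod int p)" for U g i
    using neg_C[of i] by (simp add: Hom_act_def rev_def carrier_Zp[OF p] mod_simps mod_minus_eq)
  ultimately have "\<exists>U\<in>?H. Xind_Hom p V E + enat p \<le> enat (balanced_size ?C (\<lambda>i. c ` rev U i))"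
    unfolding Xind_Hom_def using fin p colors_disjoint[OF assms(3) complete]
    by (intro cross_index_le_balanced_size[OF assms(1)]) auto
  then show ?thesis using rev_sub complete by blast
qed

theorem corollary1:
  fixes p :: nat and V :: "'v set" and E :: "'v set set" and c :: "'v \<Rightarrow> 'c"
  assumes "prime p"
    and "is_graph V E" and "E \<noteq> {}"
    and "proper_coloring E c"
  shows "(\<exists>n W F. is_subgraph W F V E \<and> multicolored c W \<and>
            is_complete_multipartite_graph p n W F \<and>
            enat (\<Sum>i=1..p. n i) = ind_box p V E + 1 \<and>
            (\<forall>i\<in>{1..p}. \<forall>j\<in>{1..p}. \<bar>int (n i) - int (n j)\<bar> \<le> 1)) \<and>
         (p \<le> clique_number V E \<longrightarrow>
          (\<exists>n W F. is_subgraph W F V E \<and> multicolored c W \<and>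
            is_complete_multipartite_graph p n W F \<and>
            enat (\<Sum>i=1..p. n i) = Xind_Hom p V E + enat p \<and>
            (\<forall>i\<in>{1..p}. \<forall>j\<in>{1..p}. \<bar>int (n i) - int (n j)\<bar> \<le> 1)))"
proof -
  have p: "0 < p" using prime_gt_0_nat[OF assms(1)] .
  have subgraph: "\<exists>n W F. is_subgraph W F V E \<and> multicolored c W \<and>
            is_complete_multipartite_graph p n W F \<and> enat (\<Sum>i=1..p. n i) = t \<and>
            (\<forall>i\<in>{1..p}. \<forall>j\<in>{1..p}. \<bar>int (n i) - int (n j)\<bar> \<le> 1)"
    if U: "\<And>i. i \<in> {0..<int p} \<Longrightarrow> U i \<subseteq> V" "complete_multipartite E {0..<int p} U"
      and t: "t \<le> enat (balanced_size {0..<int p} (\<lambda>i. c ` U i))" for U t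
  proof -
    obtain s where s: "t = enat s" "s \<le> balanced_size {0..<int p} (\<lambda>i. c ` U i)"
      using t by (cases t) auto
    show ?thesis
      using multicolored_subgraph_exists[OF assms(2,4) p U s(2)] unfolding s(1) by simp
  qed
  have "V \<noteq> {}"
    using assms(2,3) by (auto simp: is_graph_def nsets_def)
  then obtain S where "S \<in> box_complex p V E"
    "ind_box p V E + 1 \<le> enat (balanced_size {0..<int p} (\<lambda>i. c ` (S `` {i})))"
    using ind_box_le_balanced_size[OF assms(1,2) _ assms(4)] by blast
  then have "\<exists>n W F. is_subgraph W F V E \<and> multicolored c W \<and>
            is_complete_multipartite_graph p n W F \<and> enat (\<Sum>i=1..p. n i) = ind_box p V E + 1 \<and>
            (\<forall>i\<in>{1..p}. \<forall>j\<in>{1..p}. \<bar>int (n i) - int (n j)\<bar> \<le> 1)"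
    by (intro subgraph[of "\<lambda>i. S `` {i}"]) (auto simp: box_complex_iff[OF p])
  moreover have "\<exists>n W F. is_subgraph W F V E \<and> multicolored c W \<and>
            is_complete_multipartite_graph p n W F \<and>
            enat (\<Sum>i=1..p. n i) = Xind_Hom p V E + enat p \<and>
            (\<forall>i\<in>{1..p}. \<forall>j\<in>{1..p}. \<bar>int (n i) - int (n j)\<bar> \<le> 1)"
    if "p \<le> clique_number V E"
    using Xind_Hom_le_balanced_size[OF assms(1,2,4) that] subgraph by blast
  ultimately show ?thesis by blast
qed

end
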